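(* Let $\Gamma$ be a connected simple graph and let $\mathcal{G}$ be its normalized Green's function. Then $$\mathrm{Tr}(\mathcal{G})=\frac{1}{\tau\,\mathrm{vol}(\Gamma)}\sum_{T_1\cup T_2\in\mathbb{F}_2}\mathrm{vol}(T_1)\,\mathrm{vol}(T_2),$$ where $\tau$ is the number of (unrooted) spanning trees of $\Gamma$ and $\mathbb{F}_2$ denotes the family of (unrooted) spanning $2$-forests of $\Gamma$.
   Context: $\Gamma=(V,E)$ is a finite undirected simple unweighted graph with at least two vertices, with adjacency matrix $A$, degrees $d_u$, and $D=\mathrm{Diag}[d_u]$. The normalized Laplacian is $\mathcal{L}=D^{-1/2}(D-A)D^{-1/2}$ and the normalized Green's function $\mathcal{G}$ is the Moore–Penrose pseudoinverse of $\mathcal{L}$. For a set $U$ of vertices $\mathrm{vol}(U)=\sum_{z\in U}d_z$ with degrees taken in $\Gamma$; for a subgraph $T$, $\mathrm{vol}(T)$ is the volume of its vertex set, and $\mathrm{vol}(\Gamma)=\mathrm{vol}(V)$. A spanning $2$-forest is a subgraph containing all vertices of $\Gamma$, with no cycles and exactly two connected components; it is written $T_1\cup T_2$, where $T_1,T_2$ are its components (unordered; each forest is counted once in the sum). *)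

theory Defs
  imports "HOL-Analysis.Analysis"
begin

section \<open>Simple graphs\<close>

text \<open>
  The vertex set is the whole finite type \<^typ>\<open>'v\<close>, and a graph is given by its set
  of edges, an edge being the set of its two endpoints.  In particular a subgraph containing
  all vertices is the same thing as a subset of the edge set.
\<close>

definition simple_graph :: "'v set set \<Rightarrow> bool" where
  "simple_graph E \<longleftrightarrow> (\<forall>e\<in>E. card e = 2)"

definition degree :: "'v set set \<Rightarrow> 'v \<Rightarrow> nat" where
  "degree E u = card {e \<in> E. u \<in> e}"

definition vol :: "'v set set \<Rightarrow> 'v set \<Rightarrow> nat" where
  "vol E U = (\<Sum>z\<in>U. degree E z)"

definition reachable :: "'v set set \<Rightarrow> ('v \<times> 'v) set" where
  "reachable E = {(u, v). {u, v} \<in> E}\<^sup>*"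

definition connected_graph :: "'v set set \<Rightarrow> bool" where
  "connected_graph E \<longleftrightarrow> (\<forall>u v. (u, v) \<in> reachable E)"

text \<open>The vertex sets of the connected components; isolated vertices are components.\<close>

definition graph_components :: "'v set set \<Rightarrow> 'v set set" where
  "graph_components E = UNIV // reachable E"

definition graph_cycle :: "'v set set \<Rightarrow> 'v list \<Rightarrow> bool" where
  "graph_cycle E vs \<longleftrightarrow> length vs \<ge> 3 \<and> distinct vs \<and>
     (\<forall>i<length vs. {vs ! i, vs ! (Suc i mod length vs)} \<in> E)"

definition forest :: "'v set set \<Rightarrow> bool" where
  "forest F \<longleftrightarrow> (\<nexists>vs. graph_cycle F vs)"

definition spanning_trees :: "'v set set \<Rightarrow> 'v set set set" where
  "spanning_trees E = {T. T \<subseteq> E \<and> forest T \<and> connected_graph T}"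

definition spanning_two_forests :: "'v set set \<Rightarrow> 'v set set set" where
  "spanning_two_forests E = {F. F \<subseteq> E \<and> forest F \<and> card (graph_components F) = 2}"


section \<open>Moore--Penrose pseudoinverse\<close>

definition moore_penrose :: "real^'n^'m \<Rightarrow> real^'m^'n \<Rightarrow> bool" where
  "moore_penrose A X \<longleftrightarrow>
     A ** X ** A = A \<and> X ** A ** X = X \<and>
     transpose (A ** X) = A ** X \<and> transpose (X ** A) = X ** A"

definition pinv :: "real^'n^'m \<Rightarrow> real^'m^'n" where
  "pinv A = (THE X. moore_penrose A X)"

lemma moore_penrose_unique:
  assumes X: "moore_penrose A X" and Y: "moore_penrose A Y"
  shows "X = Y"
proof -
  note defs = moore_penrose_def
  have AXY: "A ** X = A ** Y"
  proof -
    have "A ** X = (A ** Y) ** (A ** X)"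
      using Y by (metis defs matrix_mul_assoc)
    also have "\<dots> = transpose ((A ** X) ** (A ** Y))"
      using X Y by (simp add: defs matrix_transpose_mul)
    also have "(A ** X) ** (A ** Y) = A ** Y"
      using X by (metis defs matrix_mul_assoc)
    finally show ?thesis using Y by (simp add: defs)
  qed
  have XYA: "X ** A = Y ** A"
  proof -
    have "X ** A = (X ** A) ** (Y ** A)"
      using Y by (metis defs matrix_mul_assoc)
    also have "\<dots> = transpose ((Y ** A) ** (X ** A))"
      using X Y by (simp add: defs matrix_transpose_mul)
    also have "(Y ** A) ** (X ** A) = Y ** A"
      using X by (metis defs matrix_mul_assoc)
    finally show ?thesis using Y by (simp add: defs)
  qed
  have "X = X ** A ** X" using X by (simp add: defs)
  also have "\<dots> = Y ** A ** Y" by (metis AXY XYA matrix_mul_assoc)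
  finally show ?thesis using Y by (simp add: defs)
qed

lemma orthogonal_projection_exists:
  fixes S :: "'a::euclidean_space set"
  assumes S: "subspace S"
  obtains p where "linear p" "\<And>x. p x \<in> S" "\<And>x s. s \<in> S \<Longrightarrow> (x - p x) \<bullet> s = 0"
proof -
  have "\<exists>y. y \<in> S \<and> (\<forall>s\<in>S. (x - y) \<bullet> s = 0)" for x
  proof -
    obtain y z where "y \<in> span S" "\<And>w. w \<in> span S \<Longrightarrow> orthogonal z w" "x = y + z"
      using orthogonal_subspace_decomp_exists[of S x] by blast
    then show ?thesis
      using S by (intro exI[of _ y]) (auto simp: orthogonal_def span_eq_iff[THEN iffD2])
  qed
  then obtain p where p: "\<And>x. p x \<in> S" "\<And>x s. s \<in> S \<Longrightarrow> (x - p x) \<bullet> s = 0"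
    by metis
  have uniq: "p x = y" if "y \<in> S" "\<And>s. s \<in> S \<Longrightarrow> (x - y) \<bullet> s = 0" for x y
  proof -
    have d: "p x - y \<in> S" using p(1) that(1) S by (simp add: subspace_diff)
    have "(p x - y) \<bullet> (p x - y) = (x - y) \<bullet> (p x - y) - (x - p x) \<bullet> (p x - y)"
      by (simp add: inner_diff_left)
    also have "\<dots> = 0" using that(2)[OF d] p(2)[OF d] by simp
    finally show ?thesis by simp
  qed
  have "linear p"
  proof
    show "p (x + y) = p x + p y" for x y
    proof (rule uniq)
      show "p x + p y \<in> S" using p(1) S by (simp add: subspace_add)
      show "(x + y - (p x + p y)) \<bullet> s = 0" if "s \<in> S" for s
        using p(2)[OF that, of x] p(2)[OF that, of y] by (simp add: inner_diff_left inner_add_left)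
    qed
    show "p (c *\<^sub>R x) = c *\<^sub>R p x" for c x
    proof (rule uniq)
      show "c *\<^sub>R p x \<in> S" using p(1) S by (simp add: subspace_scale)
      show "(c *\<^sub>R x - c *\<^sub>R p x) \<bullet> s = 0" if "s \<in> S" for s
        using p(2)[OF that, of x] by (simp add: inner_diff_left)
    qed
  qed
  with p that show thesis by blast
qed

lemma matrix_symmetricI:
  fixes M :: "real^'n^'n"
  assumes "\<And>x y. (M *v x) \<bullet> y = x \<bullet> (M *v y)"
  shows "transpose M = M"
proof -
  have "adjoint (\<lambda>x. M *v x) = (\<lambda>x. M *v x)"
    using assms by (intro adjoint_unique) simp
  then show ?thesis
    by (simp add: adjoint_matrix matrix_eq fun_eq_iff)
qed

lemma moore_penrose_exists:
  fixes A :: "real^'n^'m"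
  shows "\<exists>X. moore_penrose A X"
proof -
  define K where "K = {x. A *v x = 0}"
  have K: "subspace K" unfolding K_def
    by (auto simp: subspace_def matrix_vector_right_distrib matrix_vector_mult_scaleR)
  obtain q where q: "linear q" "\<And>x. q x \<in> K" "\<And>x s. s \<in> K \<Longrightarrow> (x - q x) \<bullet> s = 0"
    using orthogonal_projection_exists[OF K] by metis
  have R: "subspace (range ((*v) A))"
    by (intro linear_subspace_image matrix_vector_mul_linear subspace_UNIV)
  obtain p where p: "linear p" "\<And>y. p y \<in> range ((*v) A)"
      "\<And>y s. s \<in> range ((*v) A) \<Longrightarrow> (y - p y) \<bullet> s = 0"
    using orthogonal_projection_exists[OF R] by metis
  define r where "r = (\<lambda>x. x - q x)"
  have r: "linear r" unfolding r_def using q(1) by (intro linear_compose_sub linear_ident)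
  have Ar: "A *v r x = A *v x" for x
    using q(2)[of x] by (simp add: r_def K_def matrix_vector_mult_diff_distrib)
  have V: "subspace (range r)" using r by (intro linear_subspace_image subspace_UNIV)
  have rK: "v \<bullet> s = 0" if "v \<in> range r" "s \<in> K" for v s
    using that q(3) by (auto simp: r_def)
  have rsym: "r x \<bullet> y = x \<bullet> r y" for x y
    using q(3)[OF q(2)[of y], of x] q(3)[OF q(2)[of x], of y]
    by (simp add: r_def inner_diff_left inner_diff_right inner_commute)
  have psym: "p x \<bullet> y = x \<bullet> p y" for x y
    using p(3)[OF p(2)[of y], of x] p(3)[OF p(2)[of x], of y]
    by (simp add: inner_diff_left inner_diff_right inner_commute)
  have inj: "inj_on ((*v) A) (range r)"
  proof (rule inj_onI)
    fix x y assume xy: "x \<in> range r" "y \<in> range r" "A *v x = A *v y"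
    then have "x - y \<in> range r" "x - y \<in> K"
      using V by (auto simp: subspace_diff K_def matrix_vector_mult_diff_distrib)
    from rK[OF this] show "x = y" by simp
  qed
  obtain g where g: "range g \<subseteq> range r" "linear g" "\<And>v. v \<in> range r \<Longrightarrow> g (A *v v) = v"
    using linear_exists_left_inverse_on[OF matrix_vector_mul_linear V inj] by blast
  have gA: "g (A *v x) = r x" for x
    using g(3)[of "r x"] by (simp add: Ar)
  have pA: "p (A *v x) = A *v x" for x
  proof -
    have d: "A *v x - p (A *v x) \<in> range ((*v) A)" using p(2) R by (simp add: subspace_diff)
    from p(3)[OF d, of "A *v x"] show ?thesis by simp
  qed
  have Agp: "A *v g (p y) = p y" for y
    using p(2)[of y] by (auto simp: gA Ar)
  have rr: "r (g y) = g y" for y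
  proof -
    obtain x where x: "g y = r x" using g(1) by blast
    show ?thesis unfolding x using gA[of "r x"] gA[of x] Ar[of x] by simp
  qed
  define X where "X = matrix (g \<circ> p)"
  have X: "X *v y = g (p y)" for y
    using linear_compose[OF p(1) g(2)] by (simp add: X_def matrix_works)
  have "moore_penrose A X"
    unfolding moore_penrose_def
  proof (intro conjI)
    show "A ** X ** A = A"
      by (simp add: matrix_eq X pA gA Ar flip: matrix_vector_mul_assoc)
    show "X ** A ** X = X"
      by (simp add: matrix_eq X pA gA rr flip: matrix_vector_mul_assoc)
    show "transpose (A ** X) = A ** X"
      by (rule matrix_symmetricI) (simp add: X Agp psym flip: matrix_vector_mul_assoc)
    show "transpose (X ** A) = X ** A"
      by (rule matrix_symmetricI) (simp add: X pA gA rsym flip: matrix_vector_mul_assoc)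
  qed
  then show ?thesis ..
qed

lemma moore_penrose_pinv: "moore_penrose A (pinv A)"
  unfolding pinv_def
  using moore_penrose_exists moore_penrose_unique by (metis theI)


section \<open>Normalized Laplacian and Green's function\<close>

definition diag_mat :: "('v \<Rightarrow> real) \<Rightarrow> real^'v^'v" where
  "diag_mat f = (\<chi> i j. if i = j then f i else 0)"

definition adjacency_matrix :: "('v::finite) set set \<Rightarrow> real^'v^'v" where
  "adjacency_matrix E = (\<chi> i j. if {i, j} \<in> E then 1 else 0)"

text \<open>
  The power \<open>D\<^sup>-\<^sup>1\<^sup>/\<^sup>2\<close> is taken entrywise on the diagonal; the degrees are positive for a
  connected graph with at least two vertices.
\<close>

definition normalized_laplacian :: "('v::finite) set set \<Rightarrow> real^'v^'v" where
  "normalized_laplacian E =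
     (let D = diag_mat (\<lambda>u. real (degree E u));
          D' = diag_mat (\<lambda>u. 1 / sqrt (real (degree E u)))
      in D' ** (D - adjacency_matrix E) ** D')"

definition normalized_green :: "('v::finite) set set \<Rightarrow> real^'v^'v" where
  "normalized_green E = pinv (normalized_laplacian E)"

end

theory Submission
  imports Defs
begin

text \<open>
  Write \<open>d\<close> for the degrees, \<open>\<tau>\<close> for the number of spanning trees and \<open>N(x|y)\<close> for the number of
  spanning 2-forests that put \<open>x\<close> and \<open>y\<close> into different components.  Since \<open>vol(T\<^sub>1) vol(T\<^sub>2)\<close> is
  the sum of \<open>d\<^sub>x d\<^sub>y\<close> over the unordered pairs that the forest separates, the sum over 2-forests is
  half of the sum of \<open>d\<^sub>x d\<^sub>y N(x|y)\<close> over ordered pairs (lemma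
  \<open>sum_two_forests_eq_resistance\<close>).  It remains to recognize \<open>R(x,y) = N(x|y) / \<tau>\<close>, the effective
  resistance, in the Green's function.

  The link is a bijection.  Fix \<open>u \<noteq> w\<close>.  In every spanning tree the path from \<open>u\<close> to \<open>w\<close> has
  exactly one first edge \<open>{u,v}\<close>, and deleting it leaves a 2-forest with \<open>u\<close> in one component and
  \<open>v\<close>, \<open>w\<close> in the other; conversely, adding \<open>{u,v}\<close> to such a forest gives a tree.  So there are
  \<open>\<tau>\<close> such pairs \<open>(v,F)\<close> with \<open>v\<close> a neighbour of \<open>u\<close> (lemma
  \<open>card_spanning_trees_by_first_edge\<close>).  In terms of \<open>R\<close> this says that
  \<open>R(u,w) + R(u,v) - R(v,w)\<close> sums to 2 over the neighbours \<open>v\<close> of \<open>u\<close>, in other words that the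
  combinatorial Laplacian maps the column \<open>R(_,w)\<close> to \<open>-2\<close> times the unit vector at \<open>w\<close> plus a
  vector that does not depend on \<open>w\<close> (lemma \<open>laplacian_resistance\<close>).

  Thus \<open>-R/2\<close> inverts the Laplacian up to constants.  After conjugation by \<open>D\<^sup>1\<^sup>/\<^sup>2\<close> and
  compression by the orthogonal projection \<open>P\<close> away from the kernel vector \<open>(\<surd>d\<^sub>u)\<^sub>u\<close> of the normalized
  Laplacian it satisfies the Moore--Penrose equations, so it is the Green's function (lemma
  \<open>normalized_green_eq\<close>).  Its trace is read off by cyclicity, \<open>R\<close> having zero diagonal.
\<close>

section \<open>Reachability and separated pairs\<close>

lemma equiv_reachable: "equiv UNIV (reachable F)"
proof (rule equivI)
  show "sym (reachable F)"
    unfolding reachable_def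
    by (rule sym_rtrancl) (auto simp: sym_def insert_commute)
  show "refl_on UNIV (reachable F)" "trans (reachable F)"
    by (simp_all add: reachable_def refl_rtrancl trans_rtrancl)
qed simp

lemma reachable_refl [simp]: "(x, x) \<in> reachable F"
  by (simp add: reachable_def)

lemma reachable_sym: "(x, y) \<in> reachable F \<Longrightarrow> (y, x) \<in> reachable F"
  using equiv_reachable[of F] by (meson equivE symE)

lemma reachable_trans:
  "(x, y) \<in> reachable F \<Longrightarrow> (y, z) \<in> reachable F \<Longrightarrow> (x, z) \<in> reachable F"
  by (simp add: reachable_def)

lemma reachable_edge: "{x, y} \<in> F \<Longrightarrow> (x, y) \<in> reachable F"
  by (auto simp: reachable_def)

lemma reachable_step: "(x, y) \<in> reachable F \<Longrightarrow> {y, z} \<in> F \<Longrightarrow> (x, z) \<in> reachable F"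
  by (rule reachable_trans[OF _ reachable_edge])

lemma reachable_mono: "F \<subseteq> F' \<Longrightarrow> (x, y) \<in> reachable F \<Longrightarrow> (x, y) \<in> reachable F'"
  using rtrancl_mono[of "{(u, v). {u, v} \<in> F}" "{(u, v). {u, v} \<in> F'}"]
  by (auto simp: reachable_def)

lemma reachable_induct [consumes 1, case_names refl step]:
  assumes "(a, b) \<in> reachable F"
    and "P a"
    and "\<And>y z. (a, y) \<in> reachable F \<Longrightarrow> {y, z} \<in> F \<Longrightarrow> P y \<Longrightarrow> P z"
  shows "P b"
  using assms(1) unfolding reachable_def
  by (induction rule: rtrancl_induct) (use assms(2,3) in \<open>auto simp: reachable_def\<close>)

lemma graph_components_of_separated_pair:
  assumes "card (graph_components F) = 2" "(u, v) \<notin> reachable F"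
  shows "graph_components F = {reachable F `` {u}, reachable F `` {v}}"
proof -
  let ?S = "{reachable F `` {u}, reachable F `` {v}}"
  have ne: "reachable F `` {u} \<noteq> reachable F `` {v}"
    using assms(2) equiv_reachable by (metis UNIV_I eq_equiv_class)
  have "?S \<subseteq> graph_components F"
    by (auto simp: graph_components_def quotient_def)
  moreover have "finite (graph_components F)"
    using assms(1) card.infinite by fastforce
  ultimately show ?thesis
    using assms(1) ne card_subset_eq[of "graph_components F" ?S] by simp
qed

lemma reachable_from_separated_pair:
  assumes "card (graph_components F) = 2" "(u, v) \<notin> reachable F"
  shows "(u, x) \<in> reachable F \<or> (v, x) \<in> reachable F"
proof -
  have "reachable F `` {x} \<in> graph_components F"
    by (auto simp: graph_components_def quotient_def)
  with graph_components_of_separated_pair[OF assms] have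
    "reachable F `` {x} = reachable F `` {u} \<or> reachable F `` {x} = reachable F `` {v}" by auto
  then show ?thesis by auto
qed

lemma card_graph_components_eq_2I:
  assumes "(u, v) \<notin> reachable F" "\<And>x. (u, x) \<in> reachable F \<or> (v, x) \<in> reachable F"
  shows "card (graph_components F) = 2"
proof -
  have cls: "reachable F `` {x} = reachable F `` {y}" if "(y, x) \<in> reachable F" for x y
    using that equiv_reachable by (metis equiv_class_eq)
  have "reachable F `` {x} \<in> {reachable F `` {u}, reachable F `` {v}}" for x
    using assms(2)[of x] cls by blast
  then have "graph_components F = {reachable F `` {u}, reachable F `` {v}}"
    by (auto simp: graph_components_def quotient_def)
  moreover have "reachable F `` {u} \<noteq> reachable F `` {v}"
    using assms(1) equiv_reachable by (metis UNIV_I eq_equiv_class)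
  ultimately show ?thesis by simp
qed

section \<open>Edges of forests\<close>

lemma forest_mono: "forest F' \<Longrightarrow> F \<subseteq> F' \<Longrightarrow> forest F"
  unfolding forest_def graph_cycle_def by blast

text \<open>
  The path is grown edge by edge and cut back to the earlier visit whenever the new vertex already
  lies on it.
\<close>

lemma reachable_distinct_path:
  assumes "(u, v) \<in> reachable F"
  obtains p where "p \<noteq> []" "hd p = u" "last p = v" "distinct p"
    "\<And>i. Suc i < length p \<Longrightarrow> {p ! i, p ! Suc i} \<in> F"
proof -
  have "\<exists>p. p \<noteq> [] \<and> hd p = u \<and> last p = v \<and> distinct p \<and>
      (\<forall>i. Suc i < length p \<longrightarrow> {p ! i, p ! Suc i} \<in> F)"
    using assms
  proof (induction rule: reachable_induct)
    case refl
    show ?case by (rule exI[of _ "[u]"]) simp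
  next
    case (step y z)
    then obtain p where p: "p \<noteq> []" "hd p = u" "last p = y" "distinct p"
      "\<And>i. Suc i < length p \<Longrightarrow> {p ! i, p ! Suc i} \<in> F" by auto
    show ?case
    proof (cases "z \<in> set p")
      case True
      then obtain k where k: "k < length p" "p ! k = z" by (auto simp: in_set_conv_nth)
      have "last (take (Suc k) p) = z" using k by (simp add: take_Suc_conv_app_nth)
      moreover have "hd (take (Suc k) p) = u" using p by (simp add: hd_take)
      ultimately show ?thesis
        using p by (intro exI[of _ "take (Suc k) p"]) auto
    next
      case False
      have "{(p @ [z]) ! i, (p @ [z]) ! Suc i} \<in> F" if "Suc i < length (p @ [z])" for i
      proof (cases "Suc i < length p")
        case True
        then show ?thesis using p(5) by (simp add: nth_append)
      next
        case False
        with that have i: "length p = Suc i" by simp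
        with p(1,3) have "p ! i = y" by (simp add: last_conv_nth)
        with i show ?thesis using step.hyps by (simp add: nth_append)
      qed
      with p False show ?thesis by (intro exI[of _ "p @ [z]"]) auto
    qed
  qed
  then show thesis using that by blast
qed

text \<open>
  A detour around the edge, taken without repeated vertices, would close up to a cycle with it.
  The detour has at least three vertices because it avoids the edge itself.
\<close>

lemma forest_edge_is_bridge:
  assumes T: "forest T" and uv: "{u, v} \<in> T" "u \<noteq> v"
  shows "(u, v) \<notin> reachable (T - {{u, v}})"
proof
  assume "(u, v) \<in> reachable (T - {{u, v}})"
  then obtain p where p: "p \<noteq> []" "hd p = u" "last p = v" "distinct p"
    "\<And>i. Suc i < length p \<Longrightarrow> {p ! i, p ! Suc i} \<in> T - {{u, v}}"
    using reachable_distinct_path by metis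
  have ends: "p ! 0 = u" "p ! (length p - 1) = v"
    using p(1-3) by (simp_all add: hd_conv_nth last_conv_nth)
  have "length p \<noteq> 1" using ends uv(2) by auto
  moreover have "length p \<noteq> 2"
  proof
    assume "length p = 2"
    with p(5)[of 0] ends show False by simp
  qed
  ultimately have len: "3 \<le> length p"
    using p(1) by (cases "length p") auto
  have "{p ! i, p ! (Suc i mod length p)} \<in> T" if "i < length p" for i
  proof (cases "Suc i < length p")
    case True
    then show ?thesis using p(5) by simp
  next
    case False
    with that have "Suc i = length p" by simp
    then show ?thesis using ends uv(1) by (metis diff_Suc_1 insert_commute mod_self)
  qed
  with len p(4) have "graph_cycle T p" by (simp add: graph_cycle_def)
  with T show False by (auto simp: forest_def)
qed

text \<open>
  A cycle through the new edge would, once that edge is removed, still join its endpoints the other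
  way round.
\<close>

lemma forest_insert_edge:
  assumes F: "forest F" and sep: "(u, v) \<notin> reachable F"
  shows "forest (insert {u, v} F)"
  unfolding forest_def
proof
  assume "\<exists>vs. graph_cycle (insert {u, v} F) vs"
  then obtain vs where len: "length vs \<ge> 3" and dist: "distinct vs"
    and cyc: "\<And>i. i < length vs \<Longrightarrow> {vs ! i, vs ! (Suc i mod length vs)} \<in> insert {u, v} F"
    unfolding graph_cycle_def by blast
  define n where "n = length vs"
  obtain i where i: "i < n" "{vs ! i, vs ! (Suc i mod n)} \<notin> F"
    using F len dist unfolding forest_def graph_cycle_def n_def by blast
  with cyc have i_uv: "{vs ! i, vs ! (Suc i mod n)} = {u, v}" by (auto simp: n_def)
  have n0: "n \<ge> 3" using len by (simp add: n_def)
  \<comment> \<open>The new edge occurs only once on the cycle: an undirected edge could be traversed twice only if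
    the cycle had length two.\<close>
  have other: "{vs ! j, vs ! (Suc j mod n)} \<in> F" if j: "j < n" "j \<noteq> i" for j
  proof -
    have m: "Suc j mod n < n" "Suc i mod n < n" using n0 by auto
    have "{vs ! j, vs ! (Suc j mod n)} \<noteq> {vs ! i, vs ! (Suc i mod n)}"
    proof
      assume "{vs ! j, vs ! (Suc j mod n)} = {vs ! i, vs ! (Suc i mod n)}"
      then have "vs ! j = vs ! i \<or> vs ! j = vs ! (Suc i mod n) \<and> vs ! (Suc j mod n) = vs ! i"
        by (auto simp: doubleton_eq_iff)
      then have "j = i \<or> j = Suc i mod n \<and> Suc j mod n = i"
        using dist j(1) i(1) m by (simp add: nth_eq_iff_index_eq n_def)
      with j(2) have *: "j = Suc i mod n" "Suc j mod n = i" by auto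
      then show False using n0 i(1) j(1)
        by (cases "Suc i = n"; cases "Suc j = n") auto
    qed
    with i_uv cyc[of j] j(1) show ?thesis by (auto simp: n_def)
  qed
  \<comment> \<open>Walk around the cycle from the far end of the new edge back to its near end.\<close>
  have "k < n \<Longrightarrow> (vs ! (Suc i mod n), vs ! ((Suc i + k) mod n)) \<in> reachable F" for k
  proof (induction k)
    case (Suc k)
    have ne: "(Suc i + k) mod n \<noteq> i"
    proof (cases "Suc i + k < n")
      case False
      then have "(Suc i + k) mod n = Suc i + k - n"
        using Suc.prems i(1) by (simp add: le_mod_geq)
      with Suc.prems False show ?thesis by simp
    qed simp
    have "{vs ! ((Suc i + k) mod n), vs ! (Suc ((Suc i + k) mod n) mod n)} \<in> F"
      using ne n0 by (intro other) auto
    then have "(vs ! ((Suc i + k) mod n), vs ! ((Suc i + Suc k) mod n)) \<in> reachable F"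
      using reachable_edge by (simp add: mod_Suc_eq)
    with Suc show ?case using reachable_trans by fastforce
  qed simp
  from this[of "n - 1"] have "(vs ! (Suc i mod n), vs ! i) \<in> reachable F"
    using i(1) n0 by simp
  with i_uv sep show False
    by (auto simp: doubleton_eq_iff dest: reachable_sym)
qed

text \<open>
  A maximal forest spans: an edge of the graph between two of its components could be added.
\<close>

lemma spanning_tree_exists:
  fixes E :: "('v::finite) set set"
  assumes "connected_graph E"
  shows "spanning_trees E \<noteq> {}"
proof -
  let ?A = "{T. T \<subseteq> E \<and> forest T}"
  have "forest ({} :: 'v set set)"
    unfolding forest_def graph_cycle_def by fastforce
  then have "?A \<noteq> {}" by blast
  then obtain T where T: "T \<in> ?A" and max: "\<And>T'. T' \<in> ?A \<Longrightarrow> T \<subseteq> T' \<Longrightarrow> T = T'"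
    using finite_has_maximal[of ?A] by (metis finite)
  have edge: "(x, y) \<in> reachable T" if "{x, y} \<in> E" for x y
  proof (rule ccontr)
    assume sep: "(x, y) \<notin> reachable T"
    then have "T = insert {x, y} T"
      using that T forest_insert_edge by (intro max) auto
    then have "{x, y} \<in> T" by blast
    with sep show False by (blast dest: reachable_edge)
  qed
  have "(x, y) \<in> reachable T" for x y
  proof -
    have "(x, y) \<in> reachable E" using assms by (simp add: connected_graph_def)
    then show ?thesis
      by (induction rule: reachable_induct) (auto intro: edge reachable_trans)
  qed
  with T show ?thesis by (auto simp: spanning_trees_def connected_graph_def)
qed

section \<open>Cutting a spanning tree at the first edge of a path\<close>

text \<open>
  Follow a walk from \<open>u\<close> and remember the edge by which it last left \<open>u\<close>; after that the walk does
  not meet \<open>u\<close> again and so does not use this edge.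
\<close>

lemma reachable_via_first_edge:
  assumes "(u, w) \<in> reachable T" "u \<noteq> w"
  shows "\<exists>v. {u, v} \<in> T \<and> (v, w) \<in> reachable (T - {{u, v}})"
proof -
  have "u = w \<or> (\<exists>v. {u, v} \<in> T \<and> (v, w) \<in> reachable (T - {{u, v}}))"
    using assms(1)
  proof (induction rule: reachable_induct)
    case (step y z)
    show ?case
    proof (cases "u = y \<or> u = z")
      case True
      then show ?thesis using step.hyps by auto
    next
      case False
      with step.IH obtain v where v: "{u, v} \<in> T" "(v, y) \<in> reachable (T - {{u, v}})" by auto
      from False step.hyps have "{y, z} \<in> T - {{u, v}}" by (auto simp: doubleton_eq_iff)
      with v show ?thesis by (blast intro: reachable_step)
    qed
  qed simp
  with assms(2) show ?thesis by simp
qed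

text \<open>
  A vertex outside the component of \<open>a\<close> lies on no walk from \<open>a\<close>.  This carries connections over
  between the two forests obtained by deleting different edges at \<open>u\<close>.
\<close>

lemma reachable_avoiding:
  assumes "(a, b) \<in> reachable F" "(a, u) \<notin> reachable F"
  shows "(a, b) \<in> reachable {e \<in> F. u \<notin> e}"
  using assms(1)
proof (induction rule: reachable_induct)
  case (step y z)
  then have "(a, z) \<in> reachable F" by (blast intro: reachable_step)
  with step.hyps assms(2) have "{y, z} \<in> {e \<in> F. u \<notin> e}" by auto
  with step.IH show ?case by (rule reachable_step)
qed simp

text \<open>
  The part of the tree behind \<open>{u,v'}\<close> does not contain \<open>u\<close>, so it stays connected when \<open>{u,v}\<close> is
  deleted instead.  With two different first edges, \<open>u\<close> would then be joined to \<open>v\<close> via \<open>v'\<close> and \<open>w\<close>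
  without using the bridge \<open>{u,v}\<close>.
\<close>

lemma first_edge_unique:
  assumes T: "forest T" and v: "{u, v} \<in> T" "u \<noteq> v" "(v, w) \<in> reachable (T - {{u, v}})"
    and v': "{u, v'} \<in> T" "u \<noteq> v'" "(v', w) \<in> reachable (T - {{u, v'}})"
  shows "v = v'"
proof (rule ccontr)
  assume ne: "v \<noteq> v'"
  have "(v', u) \<notin> reachable (T - {{u, v'}})"
    using forest_edge_is_bridge[OF T v'(1,2)] by (blast dest: reachable_sym)
  from reachable_avoiding[OF v'(3) this] have "(v', w) \<in> reachable (T - {{u, v}})"
    by (rule reachable_mono[rotated]) auto
  moreover have "(u, v') \<in> reachable (T - {{u, v}})"
    using ne v'(1) by (intro reachable_edge) (auto simp: doubleton_eq_iff)
  ultimately have "(u, v) \<in> reachable (T - {{u, v}})"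
    using v(3) by (blast intro: reachable_sym reachable_trans)
  with forest_edge_is_bridge[OF T v(1,2)] show False by simp
qed

lemma spanning_tree_minus_edge:
  assumes T: "T \<in> spanning_trees E" and uv: "{u, v} \<in> T" "u \<noteq> v"
  shows "T - {{u, v}} \<in> spanning_two_forests E"
proof -
  let ?F = "T - {{u, v}}"
  have sep: "(u, v) \<notin> reachable ?F"
    using T uv by (intro forest_edge_is_bridge) (auto simp: spanning_trees_def)
  have "(u, x) \<in> reachable ?F \<or> (v, x) \<in> reachable ?F" for x
  proof -
    have "(u, x) \<in> reachable T" using T by (auto simp: spanning_trees_def connected_graph_def)
    then show ?thesis
    proof (induction rule: reachable_induct)
      case (step y z)
      show ?case
      proof (cases "{y, z} = {u, v}")
        case True
        then show ?thesis by (auto simp: doubleton_eq_iff)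
      next
        case False
        with step.hyps have "(y, z) \<in> reachable ?F" by (intro reachable_edge) auto
        with step.IH show ?thesis by (blast intro: reachable_trans)
      qed
    qed simp
  qed
  from card_graph_components_eq_2I[OF sep this] T show ?thesis
    by (auto simp: spanning_two_forests_def spanning_trees_def intro: forest_mono)
qed

lemma spanning_two_forest_plus_edge:
  assumes F: "F \<in> spanning_two_forests E" and uv: "{u, v} \<in> E" "(u, v) \<notin> reachable F"
  shows "insert {u, v} F \<in> spanning_trees E"
proof -
  let ?T = "insert {u, v} F"
  have c: "card (graph_components F) = 2" and f: "forest F" "F \<subseteq> E"
    using F by (auto simp: spanning_two_forests_def)
  have vu: "(u, v) \<in> reachable ?T" by (rule reachable_edge) simp
  have "(u, x) \<in> reachable ?T" for x
    using reachable_from_separated_pair[OF c uv(2), of x] vu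
      reachable_mono[OF subset_insertI, of _ _ F "{u, v}"] by (blast intro: reachable_trans)
  then have "connected_graph ?T"
    unfolding connected_graph_def by (blast intro: reachable_sym reachable_trans)
  with f uv show ?thesis by (simp add: spanning_trees_def forest_insert_edge)
qed

text \<open>
  The bijection between trees and pairs of a neighbour \<open>v\<close> of \<open>u\<close> and a forest: add, or cut, the first
  edge of the path from \<open>u\<close> to \<open>w\<close>.
\<close>

lemma card_spanning_trees_by_first_edge:
  fixes E :: "('v::finite) set set"
  assumes E: "simple_graph E" and uw: "u \<noteq> w"
  shows "card (SIGMA v:{v. {u, v} \<in> E}.
      {F \<in> spanning_two_forests E. (u, v) \<notin> reachable F \<and> (v, w) \<in> reachable F}) =
    card (spanning_trees E)" (is "card ?S = _")
proof (rule bij_betw_same_card[of "\<lambda>(v, F). insert {u, v} F"])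
  have ne: "u \<noteq> v" if "{u, v} \<in> E" for v
    using E that by (auto simp: simple_graph_def)
  show "bij_betw (\<lambda>(v, F). insert {u, v} F) ?S (spanning_trees E)"
    unfolding bij_betw_def
  proof (intro conjI inj_onI equalityI subsetI)
    fix p q assume pq: "p \<in> ?S" "q \<in> ?S"
      "(case p of (v, F) \<Rightarrow> insert {u, v} F) = (case q of (v, F) \<Rightarrow> insert {u, v} F)"
    obtain v F v' F' where p: "p = (v, F)" and q: "q = (v', F')" by fastforce
    define T where "T = insert {u, v} F"
    have T': "T = insert {u, v'} F'" using pq(3) by (simp add: p q T_def)
    have v: "{u, v} \<in> E" "F \<in> spanning_two_forests E" "(u, v) \<notin> reachable F" "(v, w) \<in> reachable F"
      and v': "{u, v'} \<in> E" "(u, v') \<notin> reachable F'" "(v', w) \<in> reachable F'"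
      using pq(1,2) by (auto simp: p q)
    have "{u, v} \<notin> F" "{u, v'} \<notin> F'"
      using v(3) v'(2) by (blast dest: reachable_edge)+
    then have F: "F = T - {{u, v}}" "F' = T - {{u, v'}}"
      using T_def T' by blast+
    have "forest T"
      using spanning_two_forest_plus_edge[OF v(2,1,3)] by (simp add: T_def spanning_trees_def)
    moreover have "{u, v} \<in> T" "{u, v'} \<in> T" by (simp add: T_def) (simp add: T')
    ultimately have "v = v'"
      using first_edge_unique[of T u v w v'] v(4) v'(3) ne[OF v(1)] ne[OF v'(1)]
      unfolding F by blast
    with F show "p = q" by (simp add: p q)
  next
    fix T assume "T \<in> (\<lambda>(v, F). insert {u, v} F) ` ?S"
    then show "T \<in> spanning_trees E" using spanning_two_forest_plus_edge by auto
  next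
    fix T assume T: "T \<in> spanning_trees E"
    then have "(u, w) \<in> reachable T" by (auto simp: spanning_trees_def connected_graph_def)
    then obtain v where v: "{u, v} \<in> T" "(v, w) \<in> reachable (T - {{u, v}})"
      using reachable_via_first_edge[OF _ uw] by blast
    have uv: "{u, v} \<in> E" using T v(1) by (auto simp: spanning_trees_def)
    have "(u, v) \<notin> reachable (T - {{u, v}})"
      using T v(1) ne[OF uv] by (intro forest_edge_is_bridge) (auto simp: spanning_trees_def)
    then have "(v, T - {{u, v}}) \<in> ?S"
      using uv v spanning_tree_minus_edge[OF T v(1) ne[OF uv]] by auto
    then show "T \<in> (\<lambda>(v, F). insert {u, v} F) ` ?S"
      using v(1) by (intro image_eqI[of _ _ "(v, T - {{u, v}})"]) auto
  qed
qed

section \<open>Effective resistance and separating forests\<close>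

definition separating_forests :: "'v set set \<Rightarrow> 'v \<Rightarrow> 'v \<Rightarrow> 'v set set set" where
  "separating_forests E x y = {F \<in> spanning_two_forests E. (x, y) \<notin> reachable F}"

text \<open>
  By Kirchhoff's formula this is the effective resistance between \<open>x\<close> and \<open>y\<close> when every edge is a
  unit resistor.
\<close>

definition resistance :: "'v set set \<Rightarrow> 'v \<Rightarrow> 'v \<Rightarrow> real" where
  "resistance E x y = real (card (separating_forests E x y)) / real (card (spanning_trees E))"

lemma resistance_refl [simp]: "resistance E x x = 0"
  by (simp add: resistance_def separating_forests_def)

lemma resistance_commute: "resistance E x y = resistance E y x"
proof -
  have "separating_forests E x y = separating_forests E y x"
    unfolding separating_forests_def using reachable_sym by metis
  then show ?thesis by (simp add: resistance_def)
qed

lemma card_separating_forests: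
  fixes E :: "('v::finite) set set"
  shows "real (card (separating_forests E x y)) =
    (\<Sum>F\<in>spanning_two_forests E. of_bool ((x, y) \<notin> reachable F))"
  by (simp add: separating_forests_def Int_def flip: sum.inter_filter)

text \<open>
  A 2-forest contributes to \<open>N(u|w) + N(u|v) - N(v|w)\<close> the amount 2 if it separates \<open>u\<close> from both \<open>v\<close>
  and \<open>w\<close>, and 0 otherwise, since three vertices cannot lie in three different components.
\<close>

lemma sum_neighbours_resistance:
  fixes E :: "('v::finite) set set"
  assumes E: "simple_graph E" "connected_graph E" and uw: "u \<noteq> w"
  shows "(\<Sum>v | {u, v} \<in> E. resistance E u w + resistance E u v - resistance E v w) = 2"
proof -
  let ?\<tau> = "real (card (spanning_trees E))"
  let ?N = "\<lambda>x y. real (card (separating_forests E x y))"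
  let ?S = "\<lambda>v. {F \<in> spanning_two_forests E. (u, v) \<notin> reachable F \<and> (v, w) \<in> reachable F}"
  have \<tau>: "?\<tau> > 0"
    using spanning_tree_exists[OF E(2)] by (simp add: card_gt_0_iff)
  have quot: "resistance E u w + resistance E u v - resistance E v w =
      (?N u w + ?N u v - ?N v w) / ?\<tau>" for v
    by (simp add: resistance_def add_divide_distrib diff_divide_distrib)
  have "?N u w + ?N u v - ?N v w = 2 * real (card (?S v))" for v
  proof -
    have "of_bool ((u, w) \<notin> reachable F) + of_bool ((u, v) \<notin> reachable F)
        - of_bool ((v, w) \<notin> reachable F) =
      (2 * of_bool ((u, v) \<notin> reachable F \<and> (v, w) \<in> reachable F) :: real)"
      if F: "F \<in> spanning_two_forests E" for F
    proof -
      have c: "card (graph_components F) = 2" using F by (simp add: spanning_two_forests_def)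
      have "(u, w) \<in> reachable F" if "(u, v) \<notin> reachable F" "(v, w) \<notin> reachable F"
        using reachable_from_separated_pair[OF c that(1), of w] that(2) by blast
      moreover have "(u, w) \<in> reachable F \<longleftrightarrow> (v, w) \<in> reachable F" if "(u, v) \<in> reachable F"
        using that reachable_sym reachable_trans by metis
      moreover have "(u, w) \<notin> reachable F" if "(u, v) \<notin> reachable F" "(v, w) \<in> reachable F"
        using that reachable_sym reachable_trans by metis
      ultimately show ?thesis by (auto simp: of_bool_def)
    qed
    then have "?N u w + ?N u v - ?N v w = (\<Sum>F\<in>spanning_two_forests E.
        2 * of_bool ((u, v) \<notin> reachable F \<and> (v, w) \<in> reachable F))"
      unfolding card_separating_forests sum.distrib[symmetric] sum_subtractf[symmetric]
      by (rule sum.cong[OF refl])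
    then show ?thesis
      by (simp add: Int_def flip: sum_distrib_left)
  qed
  then have "(\<Sum>v | {u, v} \<in> E. ?N u w + ?N u v - ?N v w) =
      2 * real (\<Sum>v | {u, v} \<in> E. card (?S v))"
    by (simp add: sum_distrib_left)
  also have "(\<Sum>v | {u, v} \<in> E. card (?S v)) = card (SIGMA v:{v. {u, v} \<in> E}. ?S v)"
    by simp
  also have "\<dots> = card (spanning_trees E)"
    by (rule card_spanning_trees_by_first_edge[OF E(1) uw])
  finally show ?thesis
    using \<tau> unfolding quot sum_divide_distrib[symmetric]
    by (simp add: card_gt_0_iff)
qed

text \<open>
  The factor 2 accounts for ordered pairs: each component may hold the first vertex.
\<close>

lemma prod_vol_components:
  fixes E :: "('v::finite) set set"
  assumes c: "card (graph_components F) = 2"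
  shows "2 * (\<Prod>T\<in>graph_components F. real (vol E T)) =
    (\<Sum>x\<in>UNIV. \<Sum>y\<in>UNIV. real (degree E x) * real (degree E y) * of_bool ((x, y) \<notin> reachable F))"
proof -
  obtain C C' where CC: "graph_components F = {C, C'}" "C \<noteq> C'"
    using c by (auto simp: card_2_iff)
  have U: "C \<union> C' = UNIV" 
    using CC(1) Union_quotient[OF equiv_reachable[of F]] by (auto simp: graph_components_def)
  have CQ: "C \<in> UNIV // reachable F" "C' \<in> UNIV // reachable F"
    using CC(1) by (auto simp: graph_components_def)
  have D: "C \<inter> C' = {}"
    using quotient_disj[OF equiv_reachable CQ] CC(2) by blast
  have sep: "(x, y) \<notin> reachable F \<longleftrightarrow> (x \<in> C \<and> y \<in> C') \<or> (x \<in> C' \<and> y \<in> C)" for x y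
    using quotient_eq_iff[OF equiv_reachable CQ(1,1), of x y]
      quotient_eq_iff[OF equiv_reachable CQ(2,2), of x y]
      quotient_eq_iff[OF equiv_reachable CQ(1,2), of x y]
      quotient_eq_iff[OF equiv_reachable CQ(2,1), of x y] U D CC(2) by blast
  let ?d = "\<lambda>x. real (degree E x)"
  have "(\<Sum>x\<in>UNIV. \<Sum>y\<in>UNIV. ?d x * ?d y * of_bool ((x, y) \<notin> reachable F)) =
    (\<Sum>x\<in>UNIV. \<Sum>y\<in>UNIV. (?d x * of_bool (x \<in> C)) * (?d y * of_bool (y \<in> C')) +
       (?d x * of_bool (x \<in> C')) * (?d y * of_bool (y \<in> C)))"
    using D by (intro sum.cong refl) (auto simp: sep of_bool_def)
  also have "\<dots> = 2 * ((\<Sum>x\<in>UNIV. ?d x * of_bool (x \<in> C)) * (\<Sum>x\<in>UNIV. ?d x * of_bool (x \<in> C')))"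
    by (simp add: sum.distrib flip: sum_product)
  also have "\<dots> = 2 * (real (vol E C) * real (vol E C'))"
    by (simp add: vol_def of_bool_def sum.inter_restrict[symmetric] if_distrib[of "(*) _"] sum.If_cases)
  finally show ?thesis using CC by simp
qed

lemma sum_two_forests_eq_resistance:
  fixes E :: "('v::finite) set set"
  assumes "connected_graph E"
  shows "(\<Sum>F\<in>spanning_two_forests E. \<Prod>T\<in>graph_components F. real (vol E T)) =
    real (card (spanning_trees E)) / 2 *
      (\<Sum>x\<in>UNIV. \<Sum>y\<in>UNIV. real (degree E x) * real (degree E y) * resistance E x y)"
proof -
  let ?d = "\<lambda>x. real (degree E x)"
  have \<tau>: "real (card (spanning_trees E)) \<noteq> 0"
    using spanning_tree_exists[OF assms] by simp
  have "2 * (\<Sum>F\<in>spanning_two_forests E. \<Prod>T\<in>graph_components F. real (vol E T)) =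
    (\<Sum>F\<in>spanning_two_forests E. \<Sum>x\<in>UNIV. \<Sum>y\<in>UNIV. ?d x * ?d y * of_bool ((x, y) \<notin> reachable F))"
    unfolding sum_distrib_left
    by (intro sum.cong refl prod_vol_components) (simp add: spanning_two_forests_def)
  also have "\<dots> = (\<Sum>x\<in>UNIV. \<Sum>F\<in>spanning_two_forests E. \<Sum>y\<in>UNIV. ?d x * ?d y * of_bool ((x, y) \<notin> reachable F))"
    by (rule sum.swap)
  also have "\<dots> = (\<Sum>x\<in>UNIV. \<Sum>y\<in>UNIV. \<Sum>F\<in>spanning_two_forests E. ?d x * ?d y * of_bool ((x, y) \<notin> reachable F))"
    by (intro sum.cong refl sum.swap)
  also have "\<dots> = (\<Sum>x\<in>UNIV. \<Sum>y\<in>UNIV. ?d x * ?d y * real (card (separating_forests E x y)))"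
    unfolding card_separating_forests by (simp only: sum_distrib_left)
  also have "\<dots> = real (card (spanning_trees E)) * (\<Sum>x\<in>UNIV. \<Sum>y\<in>UNIV. ?d x * ?d y * resistance E x y)"
    unfolding sum_distrib_left using \<tau> by (intro sum.cong refl) (simp add: resistance_def)
  finally show ?thesis by simp
qed

section \<open>The Green's function\<close>

lemma degree_eq_card_neighbours:
  fixes E :: "('v::finite) set set"
  assumes "simple_graph E"
  shows "degree E u = card {v. {u, v} \<in> E}"
proof -
  have "bij_betw (\<lambda>v. {u, v}) {v. {u, v} \<in> E} {e \<in> E. u \<in> e}"
  proof (rule bij_betw_imageI)
    show "inj_on (\<lambda>v. {u, v}) {v. {u, v} \<in> E}"
      by (auto simp: inj_on_def doubleton_eq_iff)
    show "(\<lambda>v. {u, v}) ` {v. {u, v} \<in> E} = {e \<in> E. u \<in> e}"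
    proof (intro equalityI subsetI)
      fix e assume e: "e \<in> {e \<in> E. u \<in> e}"
      then have "card e = 2" using assms by (simp add: simple_graph_def)
      with e obtain v where "e = {u, v}" by (auto simp: card_2_iff)
      with e show "e \<in> (\<lambda>v. {u, v}) ` {v. {u, v} \<in> E}" by auto
    qed auto
  qed
  then show ?thesis by (simp add: degree_def bij_betw_same_card)
qed

lemma degree_pos:
  fixes E :: "('v::finite) set set"
  assumes "connected_graph E" "CARD('v) \<ge> 2"
  shows "degree E u > 0"
proof -
  have "\<exists>w. u \<noteq> w"
  proof (rule ccontr)
    assume "\<nexists>w. u \<noteq> w"
    then have "UNIV = {u}" by auto
    then have "card (UNIV :: 'v set) = card {u}" by (rule arg_cong)
    with assms(2) show False by simp
  qed
  then obtain w where "u \<noteq> w" by blast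
  moreover have "(u, w) \<in> reachable E" using assms(1) by (simp add: connected_graph_def)
  ultimately obtain v where "{u, v} \<in> E" using reachable_via_first_edge[of u w E] by blast
  then have "{e \<in> E. u \<in> e} \<noteq> {}" by blast
  then show ?thesis by (simp add: degree_def card_gt_0_iff)
qed

lemma matrix_diff_ldistrib:
  fixes A :: "real^'n^'m" and B C :: "real^'p^'n"
  shows "A ** (B - C) = A ** B - A ** C"
  by (simp add: vec_eq_iff matrix_matrix_mult_def right_diff_distrib sum_subtractf)

lemma matrix_diff_rdistrib:
  fixes A B :: "real^'n^'m" and C :: "real^'p^'n"
  shows "(A - B) ** C = A ** C - B ** C"
  by (simp add: vec_eq_iff matrix_matrix_mult_def left_diff_distrib sum_subtractf)

lemma vol_pos:
  fixes E :: "('v::finite) set set"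
  assumes "connected_graph E" "CARD('v) \<ge> 2"
  shows "vol E UNIV > 0"
  unfolding vol_def using degree_pos[OF assms] by (intro sum_pos) auto

text \<open>
  Any symmetric right inverse of \<open>M\<close> modulo its kernel becomes the pseudoinverse once it is compressed
  by the orthogonal projection \<open>P\<close> onto the complement of that kernel: both products with \<open>M\<close> are
  equal to \<open>P\<close>.
\<close>

lemma moore_penrose_of_symmetric:
  fixes M P Q :: "real^'n^'n"
  assumes sym: "transpose M = M" "transpose P = P" "transpose Q = Q"
    and PP: "P ** P = P" and MP: "M ** P = M" and MQP: "M ** Q ** P = P"
  shows "moore_penrose M (P ** Q ** P)"
proof -
  let ?X = "P ** Q ** P"
  have MX: "M ** ?X = P" by (metis MP MQP matrix_mul_assoc)
  have "transpose ?X = ?X" by (simp add: matrix_transpose_mul sym matrix_mul_assoc)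
  then have XM: "?X ** M = P" using MX sym by (metis matrix_transpose_mul)
  have "P ** M = M" using MP sym by (metis matrix_transpose_mul)
  moreover have "P ** ?X = ?X" using PP by (metis matrix_mul_assoc)
  ultimately show ?thesis using MX XM sym by (simp add: moore_penrose_def)
qed

lemma diag_mat_mult_left: "(diag_mat f ** M) $ i $ j = f i * M $ i $ j"
proof -
  have "(diag_mat f ** M) $ i $ j = (\<Sum>k\<in>UNIV. if i = k then f i * M $ k $ j else 0)"
    unfolding diag_mat_def matrix_matrix_mult_def vec_lambda_beta
    by (rule sum.cong) auto
  then show ?thesis by simp
qed

lemma diag_mat_mult_right: "(M ** diag_mat f) $ i $ j = M $ i $ j * f j"
proof -
  have "(M ** diag_mat f) $ i $ j = (\<Sum>k\<in>UNIV. if k = j then M $ i $ k * f k else 0)"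
    unfolding diag_mat_def matrix_matrix_mult_def vec_lambda_beta
    by (rule sum.cong) auto
  then show ?thesis by simp
qed

definition laplacian :: "('v::finite) set set \<Rightarrow> real^'v^'v" where
  "laplacian E = diag_mat (\<lambda>u. real (degree E u)) - adjacency_matrix E"

lemma laplacian_mult:
  fixes E :: "('v::finite) set set" and f :: "'v \<Rightarrow> real"
  assumes "simple_graph E"
  shows "(\<Sum>v\<in>UNIV. laplacian E $ u $ v * f v) = (\<Sum>v | {u, v} \<in> E. f u - f v)"
proof -
  have "(\<Sum>v\<in>UNIV. laplacian E $ u $ v * f v) =
      (\<Sum>v\<in>UNIV. (if u = v then real (degree E u) * f v else 0) - (if {u, v} \<in> E then f v else 0))"
    by (intro sum.cong refl)
      (simp add: laplacian_def diag_mat_def adjacency_matrix_def left_diff_distrib)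
  also have "\<dots> = real (degree E u) * f u - (\<Sum>v | {u, v} \<in> E. f v)"
    by (simp add: sum_subtractf sum.If_cases)
  finally show ?thesis
    by (simp add: degree_eq_card_neighbours[OF assms] sum_subtractf)
qed

text \<open>
  For \<open>u \<noteq> w\<close> this rearranges \<open>sum_neighbours_resistance\<close>; on the diagonal it is immediate from
  \<open>R(w,w) = 0\<close>.  What matters is that the first summand on the right does not involve \<open>w\<close>.
\<close>

lemma laplacian_resistance:
  fixes E :: "('v::finite) set set"
  assumes "simple_graph E" "connected_graph E"
  shows "(\<Sum>v\<in>UNIV. laplacian E $ u $ v * resistance E v w) =
    (2 - (\<Sum>v | {u, v} \<in> E. resistance E u v)) - (if u = w then 2 else 0)"
proof (cases "u = w")
  case True
  then show ?thesis
    by (simp add: laplacian_mult[OF assms(1)] sum_negf resistance_commute[of E _ w])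
next
  case False
  then show ?thesis
    using sum_neighbours_resistance[OF assms False]
    by (simp add: laplacian_mult[OF assms(1)] sum.distrib sum_subtractf)
qed

text \<open>
  The orthogonal projection onto the line spanned by \<open>(\<surd>d\<^sub>u)\<^sub>u\<close>, which is the kernel of the normalized
  Laplacian of a connected graph.
\<close>

definition kernel_projection :: "('v::finite) set set \<Rightarrow> real^'v^'v" where
  "kernel_projection E =
     (\<chi> i j. sqrt (real (degree E i)) * sqrt (real (degree E j)) / real (vol E UNIV))"

text \<open>
  The vector \<open>(\<surd>d\<^sub>u)\<^sub>u\<close> has squared length \<open>vol(\<Gamma>)\<close>; hence every matrix whose rows are multiples of
  it is unchanged by right multiplication with the projection onto its line.
\<close>

lemma sum_sqrt_degree_absorb:
  fixes E :: "('v::finite) set set"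
  assumes "connected_graph E" "CARD('v) \<ge> 2"
  shows "(\<Sum>v\<in>UNIV. a * sqrt (real (degree E v)) * (sqrt (real (degree E v)) * b / real (vol E UNIV))) = a * b"
proof -
  have "(\<Sum>v\<in>UNIV. a * sqrt (real (degree E v)) * (sqrt (real (degree E v)) * b / real (vol E UNIV))) =
      (\<Sum>v\<in>UNIV. real (degree E v)) * (a * b / real (vol E UNIV))"
    unfolding sum_distrib_right by (intro sum.cong refl) simp
  also have "(\<Sum>v\<in>UNIV. real (degree E v)) = real (vol E UNIV)"
    by (simp add: vol_def)
  also have "real (vol E UNIV) * (a * b / real (vol E UNIV)) = a * b"
    using vol_pos[OF assms] by simp
  finally show ?thesis .
qed

lemma complement_kernel_projection_idem:
  fixes E :: "('v::finite) set set"
  assumes "connected_graph E" "CARD('v) \<ge> 2"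
  shows "(mat 1 - kernel_projection E) ** (mat 1 - kernel_projection E) = mat 1 - kernel_projection E"
proof -
  have "kernel_projection E ** kernel_projection E = kernel_projection E"
    using sum_sqrt_degree_absorb[OF assms, of "sqrt _ / real (vol E UNIV)"]
    by (simp add: vec_eq_iff matrix_matrix_mult_def kernel_projection_def)
  then show ?thesis
    by (simp add: matrix_diff_ldistrib matrix_diff_rdistrib)
qed

text \<open>
  The matrix \<open>D\<^sup>1\<^sup>/\<^sup>2 (- R/2) D\<^sup>1\<^sup>/\<^sup>2\<close>, an inverse of the normalized Laplacian modulo the kernel.
\<close>

definition weighted_resistance :: "('v::finite) set set \<Rightarrow> real^'v^'v" where
  "weighted_resistance E =
     (\<chi> i j. - (sqrt (real (degree E i)) * sqrt (real (degree E j)) * resistance E i j / 2))"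

lemma normalized_green_eq:
  fixes E :: "('v::finite) set set"
  assumes E: "simple_graph E" "connected_graph E" "CARD('v) \<ge> 2"
  shows "normalized_green E =
    (mat 1 - kernel_projection E) ** weighted_resistance E ** (mat 1 - kernel_projection E)"
proof -
  let ?s = "\<lambda>u. sqrt (real (degree E u))"
  let ?M = "normalized_laplacian E" and ?J = "kernel_projection E" and ?Q = "weighted_resistance E"
  let ?P = "mat 1 - ?J"
  have s: "?s u \<noteq> 0" for u using degree_pos[OF E(2,3), of u] by simp
  have M: "?M $ i $ j = laplacian E $ i $ j / (?s i * ?s j)" for i j
    by (simp add: normalized_laplacian_def Let_def diag_mat_mult_left diag_mat_mult_right
        flip: laplacian_def)
  have MJ: "?M ** ?J = 0"
  proof -
    have "(?M ** ?J) $ u $ w = 0" for u w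
    proof -
      have "(?M ** ?J) $ u $ w =
          (\<Sum>v\<in>UNIV. laplacian E $ u $ v * (?s w / (?s u * real (vol E UNIV))))"
        unfolding matrix_matrix_mult_def vec_lambda_beta kernel_projection_def M
        using s by (intro sum.cong refl) (simp del: real_sqrt_eq_zero_cancel_iff)
      also have "\<dots> = 0"
        unfolding sum_distrib_right[symmetric]
        using laplacian_mult[OF E(1), of u "\<lambda>_. 1"] by simp
      finally show ?thesis .
    qed
    then show ?thesis by (simp add: vec_eq_iff)
  qed
  \<comment> \<open>The constants that the Laplacian leaves behind form a matrix with rows proportional to the kernel
    vector, so the projection removes them.\<close>
  define c where "c u = (1 - (\<Sum>v | {u, v} \<in> E. resistance E u v) / 2) / ?s u" for u
  define K :: "real^'v^'v" where "K = (\<chi> u w. c u * ?s w)"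
  have MQ: "?M ** ?Q = mat 1 - K"
  proof -
    have "(?M ** ?Q) $ u $ w = (mat 1 - K) $ u $ w" for u w
    proof -
      have "(?M ** ?Q) $ u $ w =
          (\<Sum>v\<in>UNIV. laplacian E $ u $ v * resistance E v w * (- ?s w / (2 * ?s u)))"
        unfolding matrix_matrix_mult_def vec_lambda_beta weighted_resistance_def M
        using s by (intro sum.cong refl) (simp del: real_sqrt_eq_zero_cancel_iff add: mult_ac)
      also have "\<dots> = (mat 1 - K) $ u $ w"
        unfolding sum_distrib_right[symmetric] laplacian_resistance[OF E(1,2)] using s[of u]
        by (simp add: mat_def K_def c_def field_simps)
      finally show ?thesis .
    qed
    then show ?thesis by (simp add: vec_eq_iff)
  qed
  have KJ: "K ** ?J = K"
    using sum_sqrt_degree_absorb[OF E(2,3), of "c _" "?s _"]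
    by (simp add: vec_eq_iff matrix_matrix_mult_def K_def kernel_projection_def)
  have "moore_penrose ?M (?P ** ?Q ** ?P)"
  proof (rule moore_penrose_of_symmetric)
    show "transpose ?M = ?M"
      by (simp add: vec_eq_iff transpose_def M laplacian_def diag_mat_def adjacency_matrix_def
          insert_commute mult.commute)
    show "transpose ?P = ?P"
      by (simp add: vec_eq_iff transpose_def kernel_projection_def mat_def mult.commute)
    show "transpose ?Q = ?Q"
      by (simp add: vec_eq_iff transpose_def weighted_resistance_def resistance_commute mult.commute)
    show "?P ** ?P = ?P"
      by (rule complement_kernel_projection_idem[OF E(2,3)])
    show "?M ** ?P = ?M"
      by (simp add: matrix_diff_ldistrib MJ)
    show "?M ** ?Q ** ?P = ?P"
      by (simp add: MQ matrix_diff_ldistrib matrix_diff_rdistrib KJ)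
  qed
  then show ?thesis
    unfolding normalized_green_def using moore_penrose_pinv moore_penrose_unique by blast
qed

lemma trace_normalized_green:
  fixes E :: "('v::finite) set set"
  assumes E: "simple_graph E" "connected_graph E" "CARD('v) \<ge> 2"
  shows "trace (normalized_green E) = 1 / (2 * real (vol E UNIV)) *
    (\<Sum>x\<in>UNIV. \<Sum>y\<in>UNIV. real (degree E x) * real (degree E y) * resistance E x y)"
proof -
  let ?J = "kernel_projection E" and ?Q = "weighted_resistance E"
  let ?P = "mat 1 - ?J"
  let ?d = "\<lambda>u. real (degree E u)" and ?s = "\<lambda>u. sqrt (real (degree E u))"
  have PP: "?P ** ?P = ?P" by (rule complement_kernel_projection_idem[OF E(2,3)])
  have "trace (normalized_green E) = trace (?P ** (?P ** ?Q))"
    unfolding normalized_green_eq[OF E] by (rule trace_mul_sym)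
  also have "\<dots> = trace (?P ** ?Q)"
    by (simp add: matrix_mul_assoc PP)
  also have "\<dots> = trace ?Q - trace (?J ** ?Q)"
    by (simp add: matrix_diff_rdistrib trace_sub)
  also have "trace ?Q = 0"
    by (simp add: trace_def weighted_resistance_def)
  also have "trace (?J ** ?Q) =
      (\<Sum>x\<in>UNIV. \<Sum>y\<in>UNIV. ?d x * ?d y * resistance E x y * (- 1 / (2 * real (vol E UNIV))))"
  proof -
    have "a * b / c * - (b * a * t / 2) = (a * a) * (b * b) * t * (- 1 / (2 * c))"
      for a b c t :: real by (simp add: field_simps)
    from this[of "?s _" "?s _" "real (vol E UNIV)"]
    have "?s x * ?s y / real (vol E UNIV) * - (?s y * ?s x * resistance E y x / 2) =
        ?d x * ?d y * resistance E x y * (- 1 / (2 * real (vol E UNIV)))" for x y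
      unfolding resistance_commute[of E y x] by simp
    then show ?thesis
      unfolding trace_def matrix_matrix_mult_def vec_lambda_beta kernel_projection_def
        weighted_resistance_def by (simp only:)
  qed
  finally show ?thesis
    unfolding sum_distrib_right[symmetric] by simp
qed

theorem corollary1p7:
  fixes E :: "('v::finite) set set"
  assumes "simple_graph E"
    and "connected_graph E"
    and "CARD('v) \<ge> 2"
  shows "trace (normalized_green E) =
    1 / (real (card (spanning_trees E)) * real (vol E UNIV)) *
      (\<Sum>F\<in>spanning_two_forests E. \<Prod>T\<in>graph_components F. real (vol E T))"
proof -
  have "real (card (spanning_trees E)) \<noteq> 0"
    using spanning_tree_exists[OF assms(2)] by simp
  then show ?thesis
    by (simp add: trace_normalized_green[OF assms] sum_two_forests_eq_resistance[OF assms(2)])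
qed

end
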